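(* If two cyclically ordered quivers on $n$ vertices are related to each other by a sequence of wiggles and proper mutations, then they lie in the same $\mathbf B_n^{\pm}$-orbit.
   Context: Fix an $n$-element vertex set $V$. A quiver is a finite directed graph without loops or oriented 2-cycles; multiple arrows are allowed. Mutation $\mu_j$ of a quiver at a vertex $j$: for each path $i\to j\to k$ add an arrow $i\to k$; reverse all arrows incident to $j$; repeatedly remove oriented 2-cycles. A cyclic ordering $\sigma$ of $V$ is a linear ordering considered up to cyclic shifts ("clockwise" placement on a circle); the linear orderings in this class are called compatible with $\sigma$. A cyclically ordered quiver (COQ) $(Q,\sigma)$ is a quiver on $V$ with a cyclic ordering of $V$. A wiggle transforms $(Q,\sigma)$ into $(Q,\sigma')$ where $\sigma'$ is obtained from $\sigma$ by interchanging two vertices that are consecutive in $\sigma$ and not adjacent in $Q$. A path $i\to j\to k$ in $Q$ makes a right turn at $j$ if $\sigma=(\dots,i,\dots,j,\dots,k,\dots)$. A vertex $j$ is proper in $(Q,\sigma)$ if every oriented two-arrow path $i\to j\to k$ in $Q$ makes a right turn at $j$. Let $\operatorname{In}(j)$ (resp., $\operatorname{Out}(j)$) be the set of vertices $i$ with an arrow $i\to j$ (resp., $j\to i$) in $Q$. If $j$ is proper, the proper mutation $\mu_j(Q,\sigma)$ is the quiver $\mu_j(Q)$ with the cyclic ordering obtained from $\sigma$ by keeping the placement of all vertices other than $j$ and moving $j$ clockwise past all the vertices in $\operatorname{Out}(j)$ (each exactly once) without passing any vertex in $\operatorname{In}(j)$ (well defined up to wiggles; for a sink or source $j$ the cyclic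 ordering does not change, up to wiggles). A linearly ordered quiver is a pair $(Q,\tau)$ of a quiver $Q$ on $V$ and a linear ordering $\tau=(v_1<\dots<v_n)$ of $V$; $\operatorname{LOQ}(n)$ is the set of all of them. Its unipotent companion is the unipotent upper-triangular matrix $U=(u_{ij})$ with $u_{ij}=-b_{ij}$ for $i<j$, where $b_{ij}$ is the signed number of arrows from $v_i$ to $v_j$ (number of arrows $v_i\to v_j$ minus number of arrows $v_j\to v_i$). The pair $(U,\tau)$ determines $(Q,\tau)$. The signed braid group is $\mathbf B_n^\pm=\mathbf B_n\rtimes\{\pm1\}^n$, where $\mathbf B_n$ is the braid group with Artin generators $\sigma_1,\dots,\sigma_{n-1}$, $\rho_i\in\{\pm1\}^n$ has $-1$ in position $i$ and $1$'s elsewhere, and $\rho_k\sigma_j=\sigma_j\rho_k$ for $k\notin\{j,j+1\}$, $\rho_j\sigma_j=\sigma_j\rho_{j+1}$, $\rho_{j+1}\sigma_j=\sigma_j\rho_j$. It acts on $\operatorname{LOQ}(n)$ as follows. The generator $\sigma_k$ sends $(U,\tau)$ to $(GUG^T,\tau')$, where $G=s_k(I-u_{k,k+1}E_{k+1,k})$, $E_{k+1,k}$ is the matrix unit with $1$ in row $k+1$, column $k$, $s_k$ is the permutation matrix of the transposition $(k,k+1)$, and $\tau'$ is obtained from $\tau$ by switching its $k$th and $(k+1)$st elements. The generator $\rho_i$ keeps $\tau$ and reverses all arrows of $Q$ incident to the $i$th vertex in $\tau$. The $\mathbf B_n^\pm$-orbit of a COQ $(Q,\sigma)$ is the orbit of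 $(Q,\tau)$ for any $\tau$ compatible with $\sigma$ (it does not depend on the choice of $\tau$). *)

theory Defs
  imports "HOL-Algebra.Group_Action" "Jordan_Normal_Form.Column_Operations"
begin

section \<open>Quivers\<close>

text \<open>\<open>Q i j\<close> is the number of arrows from \<open>i\<close> to \<open>j\<close>.\<close>

type_synonym 'v quiver = "'v \<Rightarrow> 'v \<Rightarrow> nat"

definition quiver_on :: "'v set \<Rightarrow> 'v quiver \<Rightarrow> bool" where
  "quiver_on V Q \<longleftrightarrow>
     (\<forall>i j. Q i j \<noteq> 0 \<longrightarrow> i \<in> V \<and> j \<in> V) \<and>
     (\<forall>i. Q i i = 0) \<and>
     (\<forall>i j. Q i j = 0 \<or> Q j i = 0)"

definition add_composite_arrows :: "'v \<Rightarrow> 'v quiver \<Rightarrow> 'v quiver" where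
  "add_composite_arrows j Q = (\<lambda>i k. Q i k + Q i j * Q j k)"

definition reverse_at :: "'v \<Rightarrow> 'v quiver \<Rightarrow> 'v quiver" where
  "reverse_at j Q = (\<lambda>i k. if i = j \<or> k = j then Q k i else Q i k)"

text \<open>Truncated subtraction removes \<open>min (Q i k) (Q k i)\<close> oriented 2-cycles
  between \<open>i\<close> and \<open>k\<close>, which is the result of removing them one at a time.\<close>

definition remove_two_cycles :: "'v quiver \<Rightarrow> 'v quiver" where
  "remove_two_cycles Q = (\<lambda>i k. Q i k - Q k i)"

definition mutation :: "'v \<Rightarrow> 'v quiver \<Rightarrow> 'v quiver" where
  "mutation j Q = remove_two_cycles (reverse_at j (add_composite_arrows j Q))"

definition In_set :: "'v quiver \<Rightarrow> 'v \<Rightarrow> 'v set" where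
  "In_set Q j = {i. Q i j > 0}"

definition Out_set :: "'v quiver \<Rightarrow> 'v \<Rightarrow> 'v set" where
  "Out_set Q j = {i. Q j i > 0}"

section \<open>Linear and cyclic orderings, cyclically ordered quivers\<close>

definition linear_ordering :: "'v set \<Rightarrow> 'v list \<Rightarrow> bool" where
  "linear_ordering V \<tau> \<longleftrightarrow> distinct \<tau> \<and> set \<tau> = V"

text \<open>A cyclic ordering is the class of all cyclic shifts of a linear ordering, so
  \<open>\<tau> \<in> \<sigma>\<close> says that \<open>\<tau>\<close> is compatible with \<open>\<sigma>\<close>.
  Reading a list from left to right is going clockwise.\<close>

definition cyclic_class :: "'v list \<Rightarrow> 'v list set" where
  "cyclic_class \<tau> = range (\<lambda>m. rotate m \<tau>)"

definition cyclic_ordering :: "'v set \<Rightarrow> 'v list set \<Rightarrow> bool" where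
  "cyclic_ordering V \<sigma> \<longleftrightarrow> (\<exists>\<tau>. linear_ordering V \<tau> \<and> \<sigma> = cyclic_class \<tau>)"

type_synonym 'v coq = "'v quiver \<times> 'v list set"

definition COQ :: "'v set \<Rightarrow> 'v coq set" where
  "COQ V = {(Q, \<sigma>). quiver_on V Q \<and> cyclic_ordering V \<sigma>}"

definition wiggle :: "'v coq \<Rightarrow> 'v coq \<Rightarrow> bool" where
  "wiggle = (\<lambda>(Q, \<sigma>) (Q', \<sigma>').
     Q' = Q \<and>
     (\<exists>a b xs. a # b # xs \<in> \<sigma> \<and> Q a b = 0 \<and> Q b a = 0 \<and>
        \<sigma>' = cyclic_class (b # a # xs)))"

definition right_turn :: "'v list set \<Rightarrow> 'v \<Rightarrow> 'v \<Rightarrow> 'v \<Rightarrow> bool" where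
  "right_turn \<sigma> i j k \<longleftrightarrow>
     (\<exists>ws xs ys zs. ws @ [i] @ xs @ [j] @ ys @ [k] @ zs \<in> \<sigma>)"

definition proper_vertex :: "'v coq \<Rightarrow> 'v \<Rightarrow> bool" where
  "proper_vertex = (\<lambda>(Q, \<sigma>) j.
     \<forall>i k. Q i j > 0 \<longrightarrow> Q j k > 0 \<longrightarrow> right_turn \<sigma> i j k)"

text \<open>Proper mutation is well defined only up to wiggles, hence a relation: every placement
  of \<open>j\<close> reached from its old one by a clockwise move that passes all of \<open>Out(j)\<close> once
  and nothing in \<open>In(j)\<close> is admitted. Here \<open>xs\<close> are the vertices passed.\<close>

definition proper_mutation_at :: "'v \<Rightarrow> 'v coq \<Rightarrow> 'v coq \<Rightarrow> bool" where
  "proper_mutation_at j = (\<lambda>(Q, \<sigma>) (Q', \<sigma>').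
     proper_vertex (Q, \<sigma>) j \<and>
     Q' = mutation j Q \<and>
     (\<exists>xs ys. j # xs @ ys \<in> \<sigma> \<and> Out_set Q j \<subseteq> set xs \<and> In_set Q j \<inter> set xs = {} \<and>
        \<sigma>' = cyclic_class (xs @ j # ys)))"

definition coq_move :: "'v coq \<Rightarrow> 'v coq \<Rightarrow> bool" where
  "coq_move X Y \<longleftrightarrow> wiggle X Y \<or> (\<exists>j. proper_mutation_at j X Y)"

section \<open>Groups given by generators and relations\<close>

text \<open>In a word, \<open>(g, True)\<close> stands for the generator \<open>g\<close> and \<open>(g, False)\<close>
  for its inverse.\<close>

type_synonym 'g gword = "('g \<times> bool) list"

definition gwords :: "'g set \<Rightarrow> 'g gword set" where
  "gwords S = lists (S \<times> UNIV)"

inductive pres_cong :: "'g set \<Rightarrow> ('g gword \<times> 'g gword) set \<Rightarrow> 'g gword \<Rightarrow> 'g gword \<Rightarrow> bool"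
  for S R where
  refl: "w \<in> gwords S \<Longrightarrow> pres_cong S R w w"
| sym: "pres_cong S R u v \<Longrightarrow> pres_cong S R v u"
| trans: "pres_cong S R u v \<Longrightarrow> pres_cong S R v w \<Longrightarrow> pres_cong S R u w"
| app: "pres_cong S R u u' \<Longrightarrow> pres_cong S R v v' \<Longrightarrow> pres_cong S R (u @ v) (u' @ v')"
| cancel: "g \<in> S \<Longrightarrow> pres_cong S R [(g, e), (g, \<not> e)] []"
| rel: "(u, v) \<in> R \<Longrightarrow> u \<in> gwords S \<Longrightarrow> v \<in> gwords S \<Longrightarrow> pres_cong S R u v"

definition pres_class :: "'g set \<Rightarrow> ('g gword \<times> 'g gword) set \<Rightarrow> 'g gword \<Rightarrow> 'g gword set" where
  "pres_class S R w = {v. pres_cong S R w v}"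

definition presented_group ::
    "'g set \<Rightarrow> ('g gword \<times> 'g gword) set \<Rightarrow> 'g gword set monoid" where
  "presented_group S R =
     \<lparr>carrier = pres_class S R ` gwords S,
      monoid.mult = (\<lambda>X Y. \<Union>u\<in>X. \<Union>v\<in>Y. pres_class S R (u @ v)),
      one = pres_class S R []\<rparr>"

definition word_value :: "('h, 'm) monoid_scheme \<Rightarrow> ('g \<Rightarrow> 'h) \<Rightarrow> 'g gword \<Rightarrow> 'h" where
  "word_value H f w =
     foldr (\<lambda>(g, e) h. (if e then f g else inv\<^bsub>H\<^esub> (f g)) \<otimes>\<^bsub>H\<^esub> h) w \<one>\<^bsub>H\<^esub>"

text \<open>The homomorphism from a presented group to \<open>H\<close> determined by images \<open>f\<close> of the
  generators that satisfy the relations; see \<open>presented_hom_group_hom\<close> below.\<close>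

definition presented_hom :: "('h, 'm) monoid_scheme \<Rightarrow> ('g \<Rightarrow> 'h) \<Rightarrow> 'g gword set \<Rightarrow> 'h" where
  "presented_hom H f X = word_value H f (SOME w. w \<in> X)"

lemma gwords_simps [simp]:
  "[] \<in> gwords S"
  "(g, e) # w \<in> gwords S \<longleftrightarrow> g \<in> S \<and> w \<in> gwords S"
  "u @ v \<in> gwords S \<longleftrightarrow> u \<in> gwords S \<and> v \<in> gwords S"
  "rev (map (\<lambda>(g, e). (g, \<not> e)) w) \<in> gwords S \<longleftrightarrow> w \<in> gwords S"
  by (auto simp: gwords_def)

lemma pres_cong_words: "pres_cong S R u v \<Longrightarrow> u \<in> gwords S \<and> v \<in> gwords S"
  by (induction rule: pres_cong.induct) auto

lemma pres_class_eq_iff: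
  assumes "u \<in> gwords S"
  shows "pres_class S R u = pres_class S R v \<longleftrightarrow> pres_cong S R u v"
proof
  assume "pres_class S R u = pres_class S R v"
  then show "pres_cong S R u v"
    using pres_cong.refl[OF assms] pres_cong.sym unfolding pres_class_def by blast
next
  assume "pres_cong S R u v"
  then show "pres_class S R u = pres_class S R v"
    unfolding pres_class_def using pres_cong.sym pres_cong.trans by blast
qed

lemma presented_mult:
  assumes "u \<in> gwords S" "v \<in> gwords S"
  shows "pres_class S R u \<otimes>\<^bsub>presented_group S R\<^esub> pres_class S R v = pres_class S R (u @ v)"
proof -
  have "pres_class S R (u' @ v') = pres_class S R (u @ v)"
    if "pres_cong S R u u'" "pres_cong S R v v'" for u' v'
  proof -
    have "u @ v \<in> gwords S" using assms by simp
    then show ?thesis using pres_class_eq_iff[of "u @ v" S R "u' @ v'"]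
        pres_cong.app[OF that] by simp
  qed
  then have "(\<Union>u'\<in>pres_class S R u. \<Union>v'\<in>pres_class S R v. pres_class S R (u' @ v')) =
      (\<Union>u'\<in>pres_class S R u. \<Union>v'\<in>pres_class S R v. pres_class S R (u @ v))"
    by (simp add: pres_class_def[of S R u] pres_class_def[of S R v])
  moreover have "u \<in> pres_class S R u" "v \<in> pres_class S R v"
    using assms by (simp_all add: pres_class_def pres_cong.refl)
  ultimately show ?thesis unfolding presented_group_def by auto
qed

lemma pres_cong_inverse:
  assumes "w \<in> gwords S"
  shows "pres_cong S R (rev (map (\<lambda>(g, e). (g, \<not> e)) w) @ w) []"
  using assms
proof (induction w)
  case Nil
  then show ?case by (auto intro: pres_cong.refl)
next
  case (Cons a w)
  obtain g e where a: "a = (g, e)" by force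
  let ?i = "rev (map (\<lambda>(g, e). (g, \<not> e)) w)"
  have w: "w \<in> gwords S" "?i \<in> gwords S" and g: "g \<in> S" using Cons.prems a by auto
  have "pres_cong S R [(g, \<not> e), (g, e)] []"
    using pres_cong.cancel[OF g, of R "\<not> e"] by simp
  from pres_cong.app[OF pres_cong.refl[OF w(2)] pres_cong.app[OF this pres_cong.refl[OF w(1)]]]
  have "pres_cong S R (?i @ [(g, \<not> e), (g, e)] @ w) (?i @ [] @ w)" by simp
  then have "pres_cong S R (?i @ [(g, \<not> e), (g, e)] @ w) []"
    using pres_cong.trans[OF _ Cons.IH[OF w(1)]] by simp
  then show ?case by (simp add: a)
qed

lemma group_presented_group: "group (presented_group S R)"
proof (rule groupI)
  let ?G = "presented_group S R"
  have car: "carrier ?G = pres_class S R ` gwords S" and one: "\<one>\<^bsub>?G\<^esub> = pres_class S R []"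
    by (simp_all add: presented_group_def)
  show "x \<otimes>\<^bsub>?G\<^esub> y \<in> carrier ?G" if "x \<in> carrier ?G" "y \<in> carrier ?G" for x y
  proof -
    from that obtain u v where "u \<in> gwords S" "v \<in> gwords S"
      "x = pres_class S R u" "y = pres_class S R v"
      unfolding car by blast
    then show ?thesis unfolding car by (simp add: presented_mult)
  qed
  show "\<one>\<^bsub>?G\<^esub> \<in> carrier ?G" unfolding car one by simp
  show "x \<otimes>\<^bsub>?G\<^esub> y \<otimes>\<^bsub>?G\<^esub> z = x \<otimes>\<^bsub>?G\<^esub> (y \<otimes>\<^bsub>?G\<^esub> z)"
    if xyz: "x \<in> carrier ?G" "y \<in> carrier ?G" "z \<in> carrier ?G" for x y z
  proof -
    from xyz obtain u v w where "u \<in> gwords S" "v \<in> gwords S" "w \<in> gwords S"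
      "x = pres_class S R u" "y = pres_class S R v" "z = pres_class S R w"
      unfolding car by blast
    then show ?thesis by (simp only: presented_mult append_assoc gwords_simps simp_thms)
  qed
  show "\<one>\<^bsub>?G\<^esub> \<otimes>\<^bsub>?G\<^esub> x = x" if "x \<in> carrier ?G" for x
  proof -
    from that obtain w where w: "w \<in> gwords S" "x = pres_class S R w" unfolding car by blast
    then show ?thesis unfolding one w(2)
      using presented_mult[OF gwords_simps(1) w(1)] by simp
  qed
  show "\<exists>y\<in>carrier ?G. y \<otimes>\<^bsub>?G\<^esub> x = \<one>\<^bsub>?G\<^esub>" if "x \<in> carrier ?G" for x
  proof -
    from that obtain w where w: "w \<in> gwords S" "x = pres_class S R w" unfolding car by blast
    let ?i = "rev (map (\<lambda>(g, e). (g, \<not> e)) w)"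
    have i: "?i \<in> gwords S" "?i @ w \<in> gwords S" using w(1) by simp_all
    have "pres_class S R (?i @ w) = pres_class S R []"
      unfolding pres_class_eq_iff[OF i(2)] by (rule pres_cong_inverse[OF w(1)])
    then have "pres_class S R ?i \<otimes>\<^bsub>?G\<^esub> x = \<one>\<^bsub>?G\<^esub>"
      unfolding w(2) one by (simp only: presented_mult i w)
    moreover have "pres_class S R ?i \<in> carrier ?G" unfolding car using i(1) by (rule imageI)
    ultimately show ?thesis by blast
  qed
qed

context
  fixes H :: "('h, 'm) monoid_scheme" and f :: "'g \<Rightarrow> 'h" and S R
  assumes H: "group H"
    and f: "\<And>g. g \<in> S \<Longrightarrow> f g \<in> carrier H"
    and R: "\<And>u v. (u, v) \<in> R \<Longrightarrow> u \<in> gwords S \<Longrightarrow> v \<in> gwords S \<Longrightarrow>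
              word_value H f u = word_value H f v"
begin

interpretation group H by (rule H)

lemma word_value_closed: "w \<in> gwords S \<Longrightarrow> word_value H f w \<in> carrier H"
proof (induction w)
  case (Cons a w)
  then show ?case by (cases a) (auto simp: word_value_def f)
qed (simp add: word_value_def)

lemma word_value_append:
  assumes "u \<in> gwords S" "v \<in> gwords S"
  shows "word_value H f (u @ v) = word_value H f u \<otimes>\<^bsub>H\<^esub> word_value H f v"
  using assms(1)
proof (induction u)
  case Nil
  then show ?case using word_value_closed[OF assms(2)] by (simp add: word_value_def)
next
  case (Cons a u)
  obtain g e where a: "a = (g, e)" by force
  have "u \<in> gwords S" "g \<in> S" using Cons.prems a by auto
  then show ?case using Cons.IH word_value_closed[OF assms(2)] word_value_closed[of u] f[of g]
    by (simp add: word_value_def a m_assoc)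
qed

lemma word_value_cong:
  "pres_cong S R u v \<Longrightarrow> word_value H f u = word_value H f v"
proof (induction rule: pres_cong.induct)
  case (app u u' v v')
  have "u \<in> gwords S" "v \<in> gwords S" "u' \<in> gwords S" "v' \<in> gwords S"
    using pres_cong_words[OF app.hyps(1)] pres_cong_words[OF app.hyps(2)] by simp_all
  then show ?case using app.IH by (simp add: word_value_append)
next
  case (cancel g e)
  then show ?case using f[of g] by (simp add: word_value_def)
next
  case (rel u v)
  then show ?case by (rule R)
qed simp_all

lemma presented_hom_class:
  assumes "w \<in> gwords S"
  shows "presented_hom H f (pres_class S R w) = word_value H f w"
proof -
  have "(SOME v. v \<in> pres_class S R w) \<in> pres_class S R w"
    by (rule someI[of _ w]) (simp add: pres_class_def pres_cong.refl assms)
  then show ?thesis unfolding presented_hom_def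
    using word_value_cong[of w] by (simp add: pres_class_def)
qed

lemma presented_hom_group_hom: "group_hom (presented_group S R) H (presented_hom H f)"
proof (intro group_hom.intro group_hom_axioms.intro group_presented_group H homI)
  let ?G = "presented_group S R"
  have car: "carrier ?G = pres_class S R ` gwords S" by (simp add: presented_group_def)
  show "presented_hom H f x \<in> carrier H" if "x \<in> carrier ?G" for x
  proof -
    from that obtain w where "w \<in> gwords S" "x = pres_class S R w" unfolding car by blast
    then show ?thesis by (simp add: presented_hom_class word_value_closed)
  qed
  show "presented_hom H f (x \<otimes>\<^bsub>?G\<^esub> y) = presented_hom H f x \<otimes>\<^bsub>H\<^esub> presented_hom H f y"
    if "x \<in> carrier ?G" "y \<in> carrier ?G" for x y
  proof -
    from that obtain u v where "u \<in> gwords S" "v \<in> gwords S"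
      "x = pres_class S R u" "y = pres_class S R v"
      unfolding car by blast
    then show ?thesis by (simp add: presented_mult presented_hom_class word_value_append)
  qed
qed

end

section \<open>The signed braid group\<close>

datatype signed_braid_gen = Sig nat | Rho nat

definition signed_braid_gens :: "nat \<Rightarrow> signed_braid_gen set" where
  "signed_braid_gens n = Sig ` {1..<n} \<union> Rho ` {1..n}"

text \<open>The semidirect product of the braid group with \<open>{1,-1}\<^sup>n\<close>, presented by the Artin relations,
  the relations of \<open>{1,-1}\<^sup>n\<close> and the relations for moving \<open>\<rho>\<^sub>k\<close> past \<open>\<sigma>\<^sub>j\<close>.\<close>

definition signed_braid_rels ::
    "nat \<Rightarrow> (signed_braid_gen gword \<times> signed_braid_gen gword) set" where
  "signed_braid_rels n =
     (let \<sigma> = (\<lambda>j. (Sig j, True)); \<rho> = (\<lambda>k. (Rho k, True)) in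
       {([\<sigma> i, \<sigma> j], [\<sigma> j, \<sigma> i]) | i j. i \<in> {1..<n} \<and> j \<in> {1..<n} \<and> i + 2 \<le> j}
     \<union> {([\<sigma> i, \<sigma> (i + 1), \<sigma> i], [\<sigma> (i + 1), \<sigma> i, \<sigma> (i + 1)]) | i. 1 \<le> i \<and> i + 1 < n}
     \<union> {([\<rho> k, \<rho> k], []) | k. k \<in> {1..n}}
     \<union> {([\<rho> k, \<rho> l], [\<rho> l, \<rho> k]) | k l. k \<in> {1..n} \<and> l \<in> {1..n}}
     \<union> {([\<rho> k, \<sigma> j], [\<sigma> j, \<rho> k]) | k j. k \<in> {1..n} \<and> j \<in> {1..<n} \<and> k \<notin> {j, j + 1}}
     \<union> {([\<rho> j, \<sigma> j], [\<sigma> j, \<rho> (j + 1)]) | j. j \<in> {1..<n}}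
     \<union> {([\<rho> (j + 1), \<sigma> j], [\<sigma> j, \<rho> j]) | j. j \<in> {1..<n}})"

definition signed_braid_group :: "nat \<Rightarrow> signed_braid_gen gword set monoid" where
  "signed_braid_group n = presented_group (signed_braid_gens n) (signed_braid_rels n)"

section \<open>Linearly ordered quivers and the action of the signed braid group\<close>

type_synonym 'v loq = "'v quiver \<times> 'v list"

definition LOQ :: "'v set \<Rightarrow> 'v loq set" where
  "LOQ V = {(Q, \<tau>). quiver_on V Q \<and> linear_ordering V \<tau>}"

definition signed_arrows :: "'v quiver \<Rightarrow> 'v \<Rightarrow> 'v \<Rightarrow> int" where
  "signed_arrows Q v w = int (Q v w) - int (Q w v)"

text \<open>Lists and matrices are indexed from 0, generators of the signed braid group from 1.\<close>

definition unipotent_companion :: "'v loq \<Rightarrow> int mat" where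
  "unipotent_companion = (\<lambda>(Q, \<tau>). mat (length \<tau>) (length \<tau>) (\<lambda>(i, j).
     if i = j then 1 else if i < j then - signed_arrows Q (\<tau> ! i) (\<tau> ! j) else 0))"

definition loq_of_companion :: "'v set \<Rightarrow> int mat \<Rightarrow> 'v list \<Rightarrow> 'v loq" where
  "loq_of_companion V U \<tau> = (THE X. X \<in> LOQ V \<and> snd X = \<tau> \<and> unipotent_companion X = U)"

definition matrix_unit :: "nat \<Rightarrow> nat \<Rightarrow> nat \<Rightarrow> int mat" where
  "matrix_unit n p q = mat n n (\<lambda>(i, j). if i = p \<and> j = q then 1 else 0)"

definition braid_matrix :: "nat \<Rightarrow> int mat \<Rightarrow> nat \<Rightarrow> int mat" where
  "braid_matrix n U k =
     swaprows_mat n (k - 1) k * (1\<^sub>m n - U $$ (k - 1, k) \<cdot>\<^sub>m matrix_unit n k (k - 1))"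

definition switch_at :: "nat \<Rightarrow> 'a list \<Rightarrow> 'a list" where
  "switch_at k \<tau> = \<tau>[k - 1 := \<tau> ! k, k := \<tau> ! (k - 1)]"

fun generator_act :: "'v set \<Rightarrow> signed_braid_gen \<Rightarrow> 'v loq \<Rightarrow> 'v loq" where
  "generator_act V (Sig k) (Q, \<tau>) =
     (let U = unipotent_companion (Q, \<tau>); G = braid_matrix (length \<tau>) U k
      in loq_of_companion V (G * U * transpose_mat G) (switch_at k \<tau>))"
| "generator_act V (Rho i) (Q, \<tau>) = (reverse_at (\<tau> ! (i - 1)) Q, \<tau>)"

definition signed_braid_action ::
    "'v set \<Rightarrow> signed_braid_gen gword set \<Rightarrow> 'v loq \<Rightarrow> 'v loq" where
  "signed_braid_action V =
     presented_hom (BijGroup (LOQ V)) (\<lambda>g. restrict (generator_act V g) (LOQ V))"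

section \<open>The signed braid group acts on linearly ordered quivers\<close>

text \<open>The rest of this theory shows that \<open>signed_braid_action\<close> is a group action. It works
  with the skew-symmetric function \<open>b = signed_arrows Q\<close>, on which the generator
  \<open>\<sigma>\<^sub>k\<close> acts by \<open>shear 1 a c\<close>, where \<open>a\<close> and \<open>c\<close> are the \<open>k\<close>th and
  \<open>(k+1)\<close>st vertices.\<close>

definition quiver_of :: "('v \<Rightarrow> 'v \<Rightarrow> int) \<Rightarrow> 'v quiver" where
  "quiver_of b = (\<lambda>x y. nat (b x y))"

definition skew_on :: "'v set \<Rightarrow> ('v \<Rightarrow> 'v \<Rightarrow> int) \<Rightarrow> bool" where
  "skew_on V b \<longleftrightarrow> (\<forall>x y. b y x = - b x y) \<and> (\<forall>x y. b x y \<noteq> 0 \<longrightarrow> x \<in> V \<and> y \<in> V)"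

definition shear :: "int \<Rightarrow> 'v \<Rightarrow> 'v \<Rightarrow> ('v \<Rightarrow> 'v \<Rightarrow> int) \<Rightarrow> 'v \<Rightarrow> 'v \<Rightarrow> int" where
  "shear s a c b = (\<lambda>x y.
     if y = c \<and> x \<noteq> a \<and> x \<noteq> c then b x c + s * b a c * b x a
     else if x = c \<and> y \<noteq> a \<and> y \<noteq> c then b c y + s * b a c * b a y
     else b x y)"

definition flip :: "'v \<Rightarrow> ('v \<Rightarrow> 'v \<Rightarrow> int) \<Rightarrow> 'v \<Rightarrow> 'v \<Rightarrow> int" where
  "flip j b = (\<lambda>x y. if (x = j) \<noteq> (y = j) then - b x y else b x y)"

lemma skew_onD:
  assumes "skew_on V b"
  shows "b y x = - b x y" "b x x = 0" "b x y \<noteq> 0 \<Longrightarrow> x \<in> V" "b x y \<noteq> 0 \<Longrightarrow> y \<in> V"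
proof -
  show "b y x = - b x y" using assms unfolding skew_on_def by blast
  have "b x x = - b x x" using assms unfolding skew_on_def by blast
  then show "b x x = 0" by simp
next
  have "b x y \<noteq> 0 \<Longrightarrow> x \<in> V \<and> y \<in> V"
    by (rule assms[unfolded skew_on_def, THEN conjunct2, rule_format])
  then show "b x y \<noteq> 0 \<Longrightarrow> x \<in> V" "b x y \<noteq> 0 \<Longrightarrow> y \<in> V" by blast+
qed

lemma skew_onI:
  assumes "\<And>x y. b y x = - b x y" "\<And>x y. b x y \<noteq> 0 \<Longrightarrow> x \<in> V \<and> y \<in> V"
  shows "skew_on V b"
  unfolding skew_on_def
proof (rule conjI)
  show "\<forall>x y. b y x = - b x y" by (intro allI) (rule assms(1))
  show "\<forall>x y. b x y \<noteq> 0 \<longrightarrow> x \<in> V \<and> y \<in> V" by (intro allI impI) (rule assms(2))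
qed

lemma quiver_onD:
  assumes "quiver_on V Q"
  shows "Q x y \<noteq> 0 \<Longrightarrow> x \<in> V \<and> y \<in> V" "Q x y = 0 \<or> Q y x = 0"
proof -
  show "Q x y \<noteq> 0 \<Longrightarrow> x \<in> V \<and> y \<in> V"
    using assms[unfolded quiver_on_def, THEN conjunct1, rule_format, of x y] by simp
  show "Q x y = 0 \<or> Q y x = 0"
    by (rule assms[unfolded quiver_on_def, THEN conjunct2, THEN conjunct2, rule_format])
qed

lemma quiver_on_quiver_of:
  assumes "skew_on V b"
  shows "quiver_on V (quiver_of b)"
proof -
  have "nat (b i j) = 0 \<or> nat (b j i) = 0" for i j
    using skew_onD(1)[OF assms, of i j] by auto
  moreover have "i \<in> V \<and> j \<in> V" if "nat (b i j) \<noteq> 0" for i j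
    using that skew_onD(3,4)[OF assms, of i j] by fastforce
  ultimately show ?thesis
    unfolding quiver_on_def quiver_of_def using skew_onD(2)[OF assms] by simp
qed

lemma signed_arrows_quiver_of:
  assumes "skew_on V b"
  shows "signed_arrows (quiver_of b) = b"
proof (intro ext)
  fix x y
  show "signed_arrows (quiver_of b) x y = b x y"
    using skew_onD(1)[OF assms, of x y] by (auto simp: signed_arrows_def quiver_of_def)
qed

lemma skew_on_signed_arrows:
  assumes "quiver_on V Q"
  shows "skew_on V (signed_arrows Q)"
proof -
  have "x \<in> V \<and> y \<in> V" if "signed_arrows Q x y \<noteq> 0" for x y
  proof -
    have "Q x y \<noteq> 0 \<or> Q y x \<noteq> 0" using that unfolding signed_arrows_def by auto
    then show ?thesis using quiver_onD(1)[OF assms, of x y] quiver_onD(1)[OF assms, of y x] by blast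
  qed
  then show ?thesis by (intro skew_onI) (simp_all add: signed_arrows_def)
qed

lemma quiver_of_signed_arrows:
  assumes "quiver_on V Q"
  shows "quiver_of (signed_arrows Q) = Q"
proof (intro ext)
  fix x y
  have "Q x y = 0 \<or> Q y x = 0" by (rule quiver_onD(2)[OF assms])
  then show "quiver_of (signed_arrows Q) x y = Q x y"
    by (auto simp: signed_arrows_def quiver_of_def)
qed

lemma skew_on_shear:
  assumes "skew_on V b" "a \<in> V" "c \<in> V"
  shows "skew_on V (shear s a c b)"
proof (rule skew_onI)
  fix x y
  show "shear s a c b y x = - shear s a c b x y"
    using skew_onD(1)[OF assms(1), of x y] skew_onD(1)[OF assms(1), of a x]
      skew_onD(1)[OF assms(1), of a y]
    by (auto simp: shear_def)
next
  fix x y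
  assume "shear s a c b x y \<noteq> 0"
  then consider "b x y \<noteq> 0" | "y = c" "b x a \<noteq> 0" | "x = c" "b a y \<noteq> 0"
    by (fastforce simp: shear_def split: if_splits)
  then show "x \<in> V \<and> y \<in> V"
  proof cases
    case 1
    then show ?thesis using skew_onD(3,4)[OF assms(1) 1] by simp
  next
    case 2
    then show ?thesis using skew_onD(3)[OF assms(1) 2(2)] assms(3) by simp
  next
    case 3
    then show ?thesis using skew_onD(4)[OF assms(1) 3(2)] assms(3) by simp
  qed
qed

lemma skew_on_flip:
  assumes "skew_on V b"
  shows "skew_on V (flip j b)"
proof -
  have "flip j b y x = - flip j b x y" for x y
    using skew_onD(1)[OF assms, of y x] by (auto simp: flip_def)
  moreover have "x \<in> V \<and> y \<in> V" if "flip j b x y \<noteq> 0" for x y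
  proof -
    have "b x y \<noteq> 0" using that by (simp add: flip_def split: if_splits)
    then show ?thesis using skew_onD(3,4)[OF assms, of x y] by simp
  qed
  ultimately show ?thesis by (rule skew_onI)
qed

lemma shear_shear_inverse:
  assumes "a \<noteq> c"
  shows "shear (- s) a c (shear s a c b) = b"
  using assms by (intro ext) (auto simp: shear_def)

lemma flip_flip: "flip j (flip j b) = b"
  by (intro ext) (auto simp: flip_def)

lemma flip_commute: "flip i (flip j b) = flip j (flip i b)"
  by (intro ext) (auto simp: flip_def)

lemma flip_shear:
  shows "flip j (shear s a c b) = shear s a c (flip j b)"
proof (intro ext)
  fix x y
  define \<epsilon> :: "_ \<Rightarrow> int" where "\<epsilon> v = (if v = j then - 1 else 1)" for v
  have sq: "\<epsilon> v * (\<epsilon> v * t) = t" for v t by (simp add: \<epsilon>_def)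
  have flip: "flip j b' v w = \<epsilon> v * (\<epsilon> w * b' v w)" for b' v w
    by (simp add: flip_def \<epsilon>_def)
  have "\<epsilon> v * (\<epsilon> c * (b v c + s * b a c * b v a)) =
      \<epsilon> v * (\<epsilon> c * b v c) + s * (\<epsilon> a * (\<epsilon> c * b a c)) * (\<epsilon> v * (\<epsilon> a * b v a))" for v
  proof -
    have "s * (\<epsilon> a * (\<epsilon> c * b a c)) * (\<epsilon> v * (\<epsilon> a * b v a)) =
        \<epsilon> a * (\<epsilon> a * (\<epsilon> v * (\<epsilon> c * (s * b a c * b v a))))" by (simp only: ac_simps)
    then show ?thesis by (simp only: sq distrib_left)
  qed
  moreover have "\<epsilon> c * (\<epsilon> v * (b c v + s * b a c * b a v)) =
      \<epsilon> c * (\<epsilon> v * b c v) + s * (\<epsilon> a * (\<epsilon> c * b a c)) * (\<epsilon> a * (\<epsilon> v * b a v))" for v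
  proof -
    have "s * (\<epsilon> a * (\<epsilon> c * b a c)) * (\<epsilon> a * (\<epsilon> v * b a v)) =
        \<epsilon> a * (\<epsilon> a * (\<epsilon> c * (\<epsilon> v * (s * b a c * b a v))))" by (simp only: ac_simps)
    then show ?thesis by (simp only: sq distrib_left)
  qed
  ultimately show "flip j (shear s a c b) x y = shear s a c (flip j b) x y"
    unfolding flip shear_def by (simp only: split: if_split) blast
qed

lemma shear_commute:
  assumes b: "skew_on V b" and "distinct [a, c, a', c']"
  shows "shear s a' c' (shear s a c b) = shear s a c (shear s a' c' b)"
proof (intro ext)
  fix x y
  note skew = skew_onD(1)[OF b, of a' c] skew_onD(1)[OF b, of a c'] skew_onD(1)[OF b, of a a']
    skew_onD(1)[OF b, of c c']
  have ne: "a \<noteq> c" "a \<noteq> a'" "a \<noteq> c'" "c \<noteq> a'" "c \<noteq> c'" "a' \<noteq> c'"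
    "c \<noteq> a" "a' \<noteq> a" "c' \<noteq> a" "a' \<noteq> c" "c' \<noteq> c" "c' \<noteq> a'"
    using assms(2) by auto
  have "v = a \<or> v = c \<or> v = a' \<or> v = c' \<or> v \<noteq> a \<and> v \<noteq> c \<and> v \<noteq> a' \<and> v \<noteq> c'" for v
    by blast
  from this[of x] this[of y]
  show "shear s a' c' (shear s a c b) x y = shear s a c (shear s a' c' b) x y"
    by (elim disjE) (simp_all add: shear_def ne skew algebra_simps)
qed

lemma shear_braid:
  assumes b: "skew_on V b" and "distinct [a, c, d]"
  shows "shear s c d (shear s a d (shear s a c b)) = shear s a c (shear s a d (shear s c d b))"
proof (intro ext)
  fix x y
  note skew = skew_onD(1)[OF b, of a c] skew_onD(1)[OF b, of a d] skew_onD(1)[OF b, of c d]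
    skew_onD(2)[OF b]
  have ne: "a \<noteq> c" "a \<noteq> d" "c \<noteq> d" "c \<noteq> a" "d \<noteq> a" "d \<noteq> c"
    using assms(2) by auto
  have "v = a \<or> v = c \<or> v = d \<or> v \<noteq> a \<and> v \<noteq> c \<and> v \<noteq> d" for v
    by blast
  from this[of x] this[of y]
  show "shear s c d (shear s a d (shear s a c b)) x y =
      shear s a c (shear s a d (shear s c d b)) x y"
    by (elim disjE) (simp_all add: shear_def ne skew algebra_simps)
qed

lemma length_switch_at [simp]: "length (switch_at k \<tau>) = length \<tau>"
  by (simp add: switch_at_def)

lemma switch_at_nth:
  assumes "k \<in> {1..<length \<tau>}" "i < length \<tau>"
  shows "switch_at k \<tau> ! i =
    (if i = k - 1 then \<tau> ! k else if i = k then \<tau> ! (k - 1) else \<tau> ! i)"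
  using assms by (auto simp: switch_at_def nth_list_update)

lemma linear_ordering_switch_at:
  assumes "linear_ordering V \<tau>" "k \<in> {1..<length \<tau>}"
  shows "linear_ordering V (switch_at k \<tau>)"
  using assms unfolding linear_ordering_def switch_at_def by (auto simp: distinct_swap)

lemma switch_at_switch_at:
  assumes "k \<in> {1..<length \<tau>}"
  shows "switch_at k (switch_at k \<tau>) = \<tau>"
  using assms by (intro nth_equalityI) (auto simp: switch_at_nth)

lemma braid_matrix_congruence:
  assumes b: "skew_on V b" and \<tau>: "linear_ordering V \<tau>" and k: "k \<in> {1..<length \<tau>}"
  defines "U \<equiv> unipotent_companion (quiver_of b, \<tau>)"
  defines "G \<equiv> braid_matrix (length \<tau>) U k"
  shows "G * U * transpose_mat G =
    unipotent_companion (quiver_of (shear 1 (\<tau> ! (k - 1)) (\<tau> ! k) b), switch_at k \<tau>)"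
proof -
  define n where "n = length \<tau>"
  obtain m where m: "k = Suc m" using k by (cases k) auto
  have mn: "m < n" "Suc m < n" using k unfolding m n_def by auto
  define u where "u = U $$ (m, Suc m)"
  define A where "A = addrow_mat n (- u) (Suc m) m"
  define S :: "int mat" where "S = swaprows_mat n (Suc m) m"
  define a c where "a = \<tau> ! m" and "c = \<tau> ! Suc m"
  have U: "U \<in> carrier_mat n n" by (simp add: U_def unipotent_companion_def n_def)
  have A: "A \<in> carrier_mat n n" "A\<^sup>T \<in> carrier_mat n n" by (simp_all add: A_def)
  have S: "S \<in> carrier_mat n n" "S\<^sup>T = S"
  proof -
    show "S \<in> carrier_mat n n" by (simp add: S_def)
    show "S\<^sup>T = S" by (rule eq_matI) (auto simp: S_def)
  qed
  have "1\<^sub>m n - u \<cdot>\<^sub>m matrix_unit n (Suc m) m = A"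
    by (rule eq_matI) (use mn in \<open>auto simp: A_def matrix_unit_def\<close>)
  moreover have "swaprows_mat n m (Suc m) = S"
    by (rule eq_matI) (auto simp: S_def)
  ultimately have G: "G = S * A"
    by (simp add: G_def braid_matrix_def m n_def[symmetric] u_def)
  have AT: "A\<^sup>T = addrow_mat n (- u) m (Suc m)"
    by (rule eq_matI) (auto simp: A_def)
  have "G * U * G\<^sup>T = S * (A * U * A\<^sup>T) * S"
  proof -
    have 1: "A * U \<in> carrier_mat n n" "A * U * A\<^sup>T \<in> carrier_mat n n" "A\<^sup>T * S \<in> carrier_mat n n"
      using A U S by auto
    have "G * U * G\<^sup>T = (S * A) * U * (A\<^sup>T * S)"
      unfolding G using transpose_mult[OF S(1) A(1)] S(2) by simp
    also have "\<dots> = S * (A * U) * (A\<^sup>T * S)"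
      using assoc_mult_mat[OF S(1) A(1) U] by simp
    also have "\<dots> = S * (A * U * (A\<^sup>T * S))"
      using assoc_mult_mat[OF S(1) 1(1) 1(3)] by simp
    also have "\<dots> = S * (A * U * A\<^sup>T * S)"
      using assoc_mult_mat[OF 1(1) A(2) S(1)] by simp
    also have "\<dots> = S * (A * U * A\<^sup>T) * S"
      using assoc_mult_mat[OF S(1) 1(2) S(1)] by simp
    finally show ?thesis .
  qed
  also have "A * U = addrow (- u) (Suc m) m U"
    unfolding A_def by (rule addrow_mat[OF U mn(1), symmetric])
  also have "addrow (- u) (Suc m) m U * A\<^sup>T = addcol (- u) (Suc m) m (addrow (- u) (Suc m) m U)"
    unfolding AT by (rule addcol_mat[symmetric]) (use U mn in simp_all)
  also have "S * addcol (- u) (Suc m) m (addrow (- u) (Suc m) m U) * S =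
      swapcols (Suc m) m (swaprows (Suc m) m (addcol (- u) (Suc m) m (addrow (- u) (Suc m) m U)))"
  proof -
    let ?W = "addcol (- u) (Suc m) m (addrow (- u) (Suc m) m U)"
    have W: "?W \<in> carrier_mat n n" "swaprows (Suc m) m ?W \<in> carrier_mat n n"
      using U by (auto intro!: carrier_matI)
    show ?thesis
      unfolding S_def swaprows_mat[OF W(1) mn(2,1), symmetric] swapcols_mat[OF W(2) mn(2,1)] ..
  qed
  also have "\<dots> = unipotent_companion (quiver_of (shear 1 a c b), switch_at k \<tau>)"
  proof -
    have V: "a \<in> V" "c \<in> V"
      using \<tau> mn unfolding a_def c_def n_def linear_ordering_def by auto
    have inj: "\<tau> ! i = \<tau> ! j \<longleftrightarrow> i = j" if "i < n" "j < n" for i j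
      using \<tau> that unfolding linear_ordering_def n_def by (simp add: nth_eq_iff_index_eq)
    have Uij: "U $$ (i, j) = (if i = j then 1 else if i < j then - b (\<tau> ! i) (\<tau> ! j) else 0)"
      if "i < n" "j < n" for i j
      using that by (simp add: U_def unipotent_companion_def n_def signed_arrows_quiver_of[OF b])
    have u: "u = - b a c" using mn by (simp add: u_def Uij a_def c_def)
    have dims: "dim_row U = n" "dim_col U = n" using U by auto
    show ?thesis
    proof (rule eq_matI)
      fix i j
      assume "i < dim_row (unipotent_companion (quiver_of (shear 1 a c b), switch_at k \<tau>))"
        and "j < dim_col (unipotent_companion (quiver_of (shear 1 a c b), switch_at k \<tau>))"
      then have ij: "i < n" "j < n" by (simp_all add: unipotent_companion_def n_def)
      have R: "unipotent_companion (quiver_of (shear 1 a c b), switch_at k \<tau>) $$ (i, j) =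
        (if i = j then 1 else if i < j
         then - shear 1 a c b (switch_at k \<tau> ! i) (switch_at k \<tau> ! j) else 0)"
        using ij by (simp add: unipotent_companion_def n_def
            signed_arrows_quiver_of[OF skew_on_shear[OF b V]])
      have nth: "switch_at k \<tau> ! p =
          (if p = m then c else if p = Suc m then a else \<tau> ! p)" if "p < n" for p
        using switch_at_nth[OF k, of p] that by (simp add: m n_def a_def c_def)
      have ne: "\<tau> ! p \<noteq> a" "\<tau> ! p \<noteq> c" if "p < n" "p \<noteq> m" "p \<noteq> Suc m" for p
        using inj[of p m] inj[of p "Suc m"] that mn unfolding a_def c_def by auto
      have ac: "a \<noteq> c" using inj[of m "Suc m"] mn unfolding a_def c_def by simp
      have ca: "c \<noteq> a" "b c a = - b a c" using ac skew_onD(1)[OF b, of c a] by auto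
      have \<tau>ac: "\<tau> ! m = a" "\<tau> ! Suc m = c" by (simp_all add: a_def c_def)
      have pos: "p = m \<or> p = Suc m \<or> (p < m \<and> p \<noteq> m \<and> p \<noteq> Suc m) \<or>
        (Suc m < p \<and> p \<noteq> m \<and> p \<noteq> Suc m)" for p
        by linarith
      show "swapcols (Suc m) m (swaprows (Suc m) m
              (addcol (- u) (Suc m) m (addrow (- u) (Suc m) m U))) $$ (i, j) =
            unipotent_companion (quiver_of (shear 1 a c b), switch_at k \<tau>) $$ (i, j)"
        unfolding R using pos[of i] pos[of j] ij mn
        by (elim disjE)
          (simp_all add: dims Uij nth u shear_def \<tau>ac ne ac ca skew_onD(2)[OF b] algebra_simps)
    qed (use U in \<open>auto simp: unipotent_companion_def n_def\<close>)
  qed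
  finally show ?thesis by (simp add: m a_def c_def)
qed

lemma unipotent_companion_inj:
  assumes "(Q, \<tau>) \<in> LOQ V" "(Q', \<tau>) \<in> LOQ V"
    and eq: "unipotent_companion (Q, \<tau>) = unipotent_companion (Q', \<tau>)"
  shows "Q = Q'"
proof -
  have Q: "quiver_on V Q" "quiver_on V Q'" and \<tau>: "set \<tau> = V"
    using assms(1,2) by (auto simp: LOQ_def linear_ordering_def)
  note skew = skew_on_signed_arrows[OF Q(1)] skew_on_signed_arrows[OF Q(2)]
  have less: "signed_arrows Q (\<tau> ! i) (\<tau> ! j) = signed_arrows Q' (\<tau> ! i) (\<tau> ! j)"
    if "i < j" "j < length \<tau>" for i j
    using arg_cong[OF eq, of "\<lambda>U. U $$ (i, j)"] that by (simp add: unipotent_companion_def)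
  have "signed_arrows Q x y = signed_arrows Q' x y" for x y
  proof (cases "x \<in> V \<and> y \<in> V")
    case True
    then obtain i j where ij: "x = \<tau> ! i" "y = \<tau> ! j" "i < length \<tau>" "j < length \<tau>"
      using \<tau> by (metis in_set_conv_nth)
    consider "i < j" | "i = j" | "j < i" by linarith
    then show ?thesis
    proof cases
      case 3
      then show ?thesis using less[of j i] ij
        skew_onD(1)[OF skew(1), of x y] skew_onD(1)[OF skew(2), of x y] by simp
    qed (use ij less skew_onD(2)[OF skew(1)] skew_onD(2)[OF skew(2)] in auto)
  next
    case False
    then show ?thesis
      using skew_onD(3,4)[OF skew(1), of x y] skew_onD(3,4)[OF skew(2), of x y] by metis
  qed
  then have "signed_arrows Q = signed_arrows Q'" by (intro ext)
  then have "quiver_of (signed_arrows Q) = quiver_of (signed_arrows Q')" by (rule arg_cong)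
  then show ?thesis unfolding quiver_of_signed_arrows[OF Q(1)] quiver_of_signed_arrows[OF Q(2)] .
qed

lemma loq_of_companion_eq:
  assumes "(Q, \<tau>) \<in> LOQ V"
  shows "loq_of_companion V (unipotent_companion (Q, \<tau>)) \<tau> = (Q, \<tau>)"
  unfolding loq_of_companion_def
proof (rule the_equality)
  fix X
  assume X: "X \<in> LOQ V \<and> snd X = \<tau> \<and> unipotent_companion X = unipotent_companion (Q, \<tau>)"
  then obtain Q' where "X = (Q', \<tau>)" by (cases X) auto
  then show "X = (Q, \<tau>)" using unipotent_companion_inj[of Q' \<tau> V Q] X assms by simp
qed (use assms in simp)

lemma LOQ_cases:
  assumes "X \<in> LOQ V"
  obtains b \<tau> where "X = (quiver_of b, \<tau>)" "skew_on V b" "linear_ordering V \<tau>"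
proof -
  obtain Q \<tau> where X: "X = (Q, \<tau>)" by force
  with assms have "quiver_on V Q" "linear_ordering V \<tau>" by (auto simp: LOQ_def)
  then show ?thesis
    using that[of "signed_arrows Q" \<tau>] X skew_on_signed_arrows quiver_of_signed_arrows by metis
qed

lemma LOQ_I: "skew_on V b \<Longrightarrow> linear_ordering V \<tau> \<Longrightarrow> (quiver_of b, \<tau>) \<in> LOQ V"
  by (simp add: LOQ_def quiver_on_quiver_of)

lemma nth_in_V: "linear_ordering V \<tau> \<Longrightarrow> i < length \<tau> \<Longrightarrow> \<tau> ! i \<in> V"
  by (auto simp: linear_ordering_def)

lemma generator_act_Sig:
  assumes "skew_on V b" "linear_ordering V \<tau>" "k \<in> {1..<length \<tau>}"
  shows "generator_act V (Sig k) (quiver_of b, \<tau>) =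
    (quiver_of (shear 1 (\<tau> ! (k - 1)) (\<tau> ! k) b), switch_at k \<tau>)"
  unfolding generator_act.simps Let_def braid_matrix_congruence[OF assms]
  using assms by (intro loq_of_companion_eq LOQ_I skew_on_shear linear_ordering_switch_at nth_in_V)
    auto

lemma generator_act_Rho:
  assumes "skew_on V b"
  shows "generator_act V (Rho k) (quiver_of b, \<tau>) = (quiver_of (flip (\<tau> ! (k - 1)) b), \<tau>)"
proof -
  have "reverse_at j (quiver_of b) x y = quiver_of (flip j b) x y" for j x y
    using skew_onD(1)[OF assms, of x y] skew_onD(2)[OF assms]
    by (auto simp: reverse_at_def quiver_of_def flip_def)
  then have "reverse_at j (quiver_of b) = quiver_of (flip j b)" for j by (intro ext)
  then show ?thesis by simp
qed

declare generator_act.simps [simp del]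

lemma linear_ordering_length: "linear_ordering V \<tau> \<Longrightarrow> length \<tau> = card V"
  by (auto simp: linear_ordering_def distinct_card)

lemma linear_ordering_nth_eq:
  "linear_ordering V \<tau> \<Longrightarrow> i < length \<tau> \<Longrightarrow> j < length \<tau> \<Longrightarrow> \<tau> ! i = \<tau> ! j \<longleftrightarrow> i = j"
  by (simp add: linear_ordering_def nth_eq_iff_index_eq)

lemma generator_act_bij:
  assumes "g \<in> signed_braid_gens (card V)"
  shows "bij_betw (generator_act V g) (LOQ V) (LOQ V)"
proof (cases g)
  case (Sig k)
  then have k: "k \<in> {1..<card V}" using assms by (auto simp: signed_braid_gens_def)
  let ?inv = "\<lambda>(Q, \<tau>).
    (quiver_of (shear (- 1) (\<tau> ! k) (\<tau> ! (k - 1)) (signed_arrows Q)), switch_at k \<tau>)"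
  have act: "generator_act V g X \<in> LOQ V \<and> ?inv X \<in> LOQ V \<and>
      ?inv (generator_act V g X) = X \<and> generator_act V g (?inv X) = X" if "X \<in> LOQ V" for X
  proof -
    from that obtain b \<tau> where X: "X = (quiver_of b, \<tau>)" and b: "skew_on V b"
      and \<tau>: "linear_ordering V \<tau>" by (rule LOQ_cases)
    have kl: "k \<in> {1..<length \<tau>}" using k linear_ordering_length[OF \<tau>] by simp
    define a c where "a = \<tau> ! (k - 1)" and "c = \<tau> ! k"
    have "k - 1 < length \<tau>" "k < length \<tau>" "k - 1 \<noteq> k" using kl by auto
    then have ac: "a \<in> V" "c \<in> V" "a \<noteq> c"
      using nth_in_V[OF \<tau>] linear_ordering_nth_eq[OF \<tau>, of "k - 1" k]
      by (simp_all add: a_def c_def)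
    note lin = linear_ordering_switch_at[OF \<tau> kl]
    note sh = skew_on_shear[OF b ac(1,2), of 1] skew_on_shear[OF b ac(2,1), of "- 1"]
    have sw: "switch_at k \<tau> ! (k - 1) = c" "switch_at k \<tau> ! k = a"
      using kl by (auto simp: switch_at_nth a_def c_def)
    note sw = sw sw[unfolded One_nat_def]
    have f: "generator_act V g X = (quiver_of (shear 1 a c b), switch_at k \<tau>)"
      unfolding X Sig generator_act_Sig[OF b \<tau> kl] a_def c_def ..
    have i: "?inv X = (quiver_of (shear (- 1) c a b), switch_at k \<tau>)"
      by (simp add: X signed_arrows_quiver_of[OF b] a_def c_def)
    have "?inv (generator_act V g X) = X"
      unfolding f using shear_shear_inverse[OF ac(3), of 1 b]
      by (simp add: signed_arrows_quiver_of[OF sh(1)] sw switch_at_switch_at[OF kl] X)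
    moreover have "generator_act V g (?inv X) = X"
    proof -
      have "generator_act V g (?inv X) =
          (quiver_of (shear 1 c a (shear (- 1) c a b)), switch_at k (switch_at k \<tau>))"
        unfolding i Sig using generator_act_Sig[OF sh(2) lin, of k] kl sw by simp
      then show ?thesis
        using shear_shear_inverse[of c a "- 1" b] ac(3) switch_at_switch_at[OF kl] X by simp
    qed
    ultimately show ?thesis unfolding f i using LOQ_I[OF sh(1) lin] LOQ_I[OF sh(2) lin] by simp
  qed
  show ?thesis by (rule bij_betw_byWitness[where f' = ?inv]) (use act in blast)+
next
  case (Rho k)
  have act: "generator_act V g X \<in> LOQ V \<and> generator_act V g (generator_act V g X) = X"
    if "X \<in> LOQ V" for X
  proof -
    from that obtain b \<tau> where X: "X = (quiver_of b, \<tau>)" and b: "skew_on V b"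
      and \<tau>: "linear_ordering V \<tau>" by (rule LOQ_cases)
    show ?thesis unfolding X Rho generator_act_Rho[OF b] generator_act_Rho[OF skew_on_flip[OF b]]
      using LOQ_I[OF skew_on_flip[OF b] \<tau>] by (simp add: flip_flip)
  qed
  show ?thesis by (rule bij_betw_byWitness[where f' = "generator_act V g"]) (use act in blast)+
qed

lemma word_value_BijGroup:
  assumes bij: "\<And>g. g \<in> S \<Longrightarrow> bij_betw (act g) E E"
    and w: "w \<in> gwords S" "\<forall>x\<in>set w. snd x"
  shows "word_value (BijGroup E) (\<lambda>g. restrict (act g) E) w =
      restrict (foldr (\<lambda>(g, e). act g) w) E \<and>
    bij_betw (foldr (\<lambda>(g, e). act g) w) E E"
  using w
proof (induction w)
  case Nil
  then show ?case using bij_betw_id[of E] by (simp add: word_value_def BijGroup_def id_def)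
next
  case (Cons x w)
  obtain g where x: "x = (g, True)" using Cons.prems by (cases x) auto
  have g: "g \<in> S" and w: "w \<in> gwords S" "\<forall>x\<in>set w. snd x" using Cons.prems x by auto
  let ?F = "foldr (\<lambda>(g, e). act g) w"
  note IH = Cons.IH[OF w, THEN conjunct1] Cons.IH[OF w, THEN conjunct2]
  have mem: "restrict (act g) E \<in> Bij E" "restrict ?F E \<in> Bij E"
    using bij[OF g] IH(2) by (auto simp: Bij_def)
  have "word_value (BijGroup E) (\<lambda>g. restrict (act g) E) (x # w) =
      restrict (act g) E \<otimes>\<^bsub>BijGroup E\<^esub> word_value (BijGroup E) (\<lambda>g. restrict (act g) E) w"
    by (simp add: word_value_def x)
  also have "\<dots> = compose E (restrict (act g) E) (restrict ?F E)"
    unfolding IH(1) using mem by (simp add: BijGroup_def)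
  also have "\<dots> = restrict (foldr (\<lambda>(g, e). act g) (x # w)) E"
    using bij_betwE[OF IH(2)] by (auto simp: compose_def x restrict_def)
  finally show ?case
  proof (rule conjI)
    show "bij_betw (foldr (\<lambda>(g, e). act g) (x # w)) E E"
      using bij_betw_trans[OF IH(2) bij[OF g]] by (simp add: x comp_def)
  qed
qed

lemma signed_braid_rels_positive:
  "(u, v) \<in> signed_braid_rels n \<Longrightarrow> (\<forall>x\<in>set u. snd x) \<and> (\<forall>x\<in>set v. snd x)"
  unfolding signed_braid_rels_def Let_def by auto

lemma switch_at_far:
  assumes "i \<in> {1..<length \<tau>}" "j \<in> {1..<length \<tau>}" "i + 2 \<le> j"
  shows "switch_at i (switch_at j \<tau>) = switch_at j (switch_at i \<tau>)"
  using assms by (intro nth_equalityI) (auto simp: switch_at_nth)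

lemma switch_at_braid:
  assumes "1 \<le> i" "i + 1 < length \<tau>"
  shows "switch_at i (switch_at (i + 1) (switch_at i \<tau>)) =
    switch_at (i + 1) (switch_at i (switch_at (i + 1) \<tau>))"
  using assms by (intro nth_equalityI) (auto simp: switch_at_nth)

lemma generator_act_rels:
  assumes R: "(u, v) \<in> signed_braid_rels (card V)" and X: "X \<in> LOQ V"
  shows "foldr (\<lambda>(g, e). generator_act V g) u X = foldr (\<lambda>(g, e). generator_act V g) v X"
proof -
  from X obtain b \<tau> where Xb: "X = (quiver_of b, \<tau>)" and b: "skew_on V b"
    and \<tau>: "linear_ordering V \<tau>" by (rule LOQ_cases)
  have len: "length \<tau> = card V" by (rule linear_ordering_length[OF \<tau>])
  note dist = linear_ordering_nth_eq[OF \<tau>]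
  note simps = generator_act_Sig generator_act_Rho skew_on_shear skew_on_flip
    linear_ordering_switch_at nth_in_V[OF \<tau>] b \<tau> switch_at_nth Xb
  note R[unfolded signed_braid_rels_def Let_def]
  then consider
    (far) i j where "i \<in> {1..<card V}" "j \<in> {1..<card V}" "i + 2 \<le> j"
      "u = [(Sig i, True), (Sig j, True)]" "v = [(Sig j, True), (Sig i, True)]"
  | (braid) i where "1 \<le> i" "i + 1 < card V"
      "u = [(Sig i, True), (Sig (i + 1), True), (Sig i, True)]"
      "v = [(Sig (i + 1), True), (Sig i, True), (Sig (i + 1), True)]"
  | (inv) k where "k \<in> {1..card V}" "u = [(Rho k, True), (Rho k, True)]" "v = []"
  | (comm) k l where "k \<in> {1..card V}" "l \<in> {1..card V}"
      "u = [(Rho k, True), (Rho l, True)]" "v = [(Rho l, True), (Rho k, True)]"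
  | (mix) k l j where "j \<in> {1..<card V}" "k \<in> {1..card V}"
      "(k \<notin> {j, j + 1} \<and> l = k) \<or> (k = j \<and> l = j + 1) \<or> (k = j + 1 \<and> l = j)"
      "u = [(Rho k, True), (Sig j, True)]" "v = [(Sig j, True), (Rho l, True)]"
    by fastforce
  then show ?thesis
  proof cases
    case far
    have d: "distinct [\<tau> ! (i - 1), \<tau> ! i, \<tau> ! (j - 1), \<tau> ! j]"
      using far len by (auto simp: dist)
    have ij: "i \<in> {1..<length \<tau>}" "j \<in> {1..<length \<tau>}" using far len by auto
    have ne: "j - Suc 0 \<noteq> i" "j - Suc 0 \<noteq> i - Suc 0" "j \<noteq> i - Suc 0" "j \<noteq> i"
      using far by auto
    show ?thesis
      using far len ne shear_commute[OF b d, of 1] switch_at_far[OF ij far(3)] by (simp add: simps)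
  next
    case braid
    have d: "distinct [\<tau> ! (i - 1), \<tau> ! i, \<tau> ! (i + 1)]"
      using braid len by (auto simp: dist)
    have i: "i + 1 < length \<tau>" using braid len by simp
    have ne: "i \<noteq> i - Suc 0" "Suc i \<noteq> i - Suc 0" "i - Suc 0 \<noteq> i" using braid by auto
    show ?thesis
      using braid len ne shear_braid[OF b d, of 1] switch_at_braid[OF braid(1) i] by (simp add: simps)
  next
    case inv
    then show ?thesis by (simp add: simps flip_flip)
  next
    case comm
    then show ?thesis by (simp add: simps flip_commute)
  next
    case mix
    have "skew_on V (shear 1 (\<tau> ! (j - 1)) (\<tau> ! j) b)"
      using mix(1) len by (intro skew_on_shear[OF b] nth_in_V[OF \<tau>]) auto
    moreover have "switch_at j \<tau> ! (k - 1) = \<tau> ! (l - 1)"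
      using mix(1-3) len by (auto simp: switch_at_nth)
    ultimately show ?thesis using mix len by (simp add: simps flip_shear)
  qed
qed

theorem group_action_signed_braid:
  "group_action (signed_braid_group (card V)) (LOQ V) (signed_braid_action V)"
  unfolding group_action_def signed_braid_group_def signed_braid_action_def
proof (rule presented_hom_group_hom[OF group_BijGroup])
  let ?f = "\<lambda>g. restrict (generator_act V g) (LOQ V)"
  show "?f g \<in> carrier (BijGroup (LOQ V))" if "g \<in> signed_braid_gens (card V)" for g
    using generator_act_bij[OF that] by (simp add: BijGroup_def Bij_def)
  fix u v
  assume R: "(u, v) \<in> signed_braid_rels (card V)"
    and u: "u \<in> gwords (signed_braid_gens (card V))"
    and v: "v \<in> gwords (signed_braid_gens (card V))"
  note pos = signed_braid_rels_positive[OF R]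
  have "word_value (BijGroup (LOQ V)) ?f u =
      restrict (foldr (\<lambda>(g, e). generator_act V g) u) (LOQ V)"
    using word_value_BijGroup[where act = "generator_act V", OF generator_act_bij u] pos by blast
  also have "\<dots> = restrict (foldr (\<lambda>(g, e). generator_act V g) v) (LOQ V)"
    by (rule restrict_ext) (rule generator_act_rels[OF R])
  also have "\<dots> = word_value (BijGroup (LOQ V)) ?f v"
    using word_value_BijGroup[where act = "generator_act V", OF generator_act_bij v] pos by simp
  finally show "word_value (BijGroup (LOQ V)) ?f u = word_value (BijGroup (LOQ V)) ?f v" .
qed

end

theory Submission
  imports Defs
begin

text \<open>Moving the first vertex \<open>a\<close> of a linear ordering to the right past a set \<open>A\<close> of vertices
  by braid generators adds \<open>b x a * b a y\<close> to \<open>b x y\<close> for \<open>x\<close> outside and \<open>y\<close> inside \<open>A\<close>;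
  the contributions to pairs inside \<open>A\<close> cancel. If \<open>a\<close> passes all other vertices,
  nothing changes, so the orbit depends only on the cyclic ordering. If \<open>A\<close> contains
  \<open>Out(a)\<close> and misses \<open>In(a)\<close>, the result is the mutation at \<open>a\<close> up to reversing the
  arrows at \<open>a\<close>. A wiggle is a braid generator whose shear is trivial.\<close>

section \<open>Orbits under single generators\<close>

abbreviation loq_orbit :: "'v set \<Rightarrow> 'v loq \<Rightarrow> 'v loq set" where
  "loq_orbit V \<equiv> orbit (signed_braid_group (card V)) (signed_braid_action V)"

text \<open>The action evaluates an arbitrarily chosen word of each class. Since the relations hold
  for the generators' actions, every word of the class has the same value, so the one-letter word
  may be evaluated instead.\<close>

lemma signed_braid_action_generator:
  assumes g: "g \<in> signed_braid_gens (card V)" and X: "X \<in> LOQ V"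
  shows "signed_braid_action V
      (pres_class (signed_braid_gens (card V)) (signed_braid_rels (card V)) [(g, True)]) X =
    generator_act V g X"
proof -
  let ?S = "signed_braid_gens (card V)" and ?R = "signed_braid_rels (card V)"
  let ?f = "\<lambda>g. restrict (generator_act V g) (LOQ V)"
  have f: "?f g \<in> carrier (BijGroup (LOQ V))" if "g \<in> ?S" for g
    using generator_act_bij[OF that] by (simp add: BijGroup_def Bij_def)
  have R: "word_value (BijGroup (LOQ V)) ?f u = word_value (BijGroup (LOQ V)) ?f v"
    if "(u, v) \<in> ?R" "u \<in> gwords ?S" "v \<in> gwords ?S" for u v
  proof -
    note pos = signed_braid_rels_positive[OF that(1)]
    have "word_value (BijGroup (LOQ V)) ?f u =
        restrict (foldr (\<lambda>(g, e). generator_act V g) u) (LOQ V)"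
      using word_value_BijGroup[where act = "generator_act V", OF generator_act_bij that(2)] pos
      by blast
    also have "\<dots> = restrict (foldr (\<lambda>(g, e). generator_act V g) v) (LOQ V)"
      by (rule restrict_ext) (rule generator_act_rels[OF that(1)])
    also have "\<dots> = word_value (BijGroup (LOQ V)) ?f v"
      using word_value_BijGroup[where act = "generator_act V", OF generator_act_bij that(3)] pos
      by simp
    finally show ?thesis .
  qed
  have w: "[(g, True)] \<in> gwords ?S" using g by simp
  have "signed_braid_action V (pres_class ?S ?R [(g, True)]) =
      word_value (BijGroup (LOQ V)) ?f [(g, True)]"
    unfolding signed_braid_action_def by (rule presented_hom_class[OF group_BijGroup f R w])
  also have "\<dots> = restrict (generator_act V g) (LOQ V)"
    using word_value_BijGroup[where act = "generator_act V", OF generator_act_bij w]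
    by (simp add: comp_def)
  finally show ?thesis using X by simp
qed

text \<open>Stated as an equality of orbits so that later steps chain as equations.\<close>

lemma loq_orbit_generator_act:
  assumes g: "g \<in> signed_braid_gens (card V)" and X: "X \<in> LOQ V"
  shows "loq_orbit V (generator_act V g X) = loq_orbit V X"
proof -
  interpret group_action "signed_braid_group (card V)" "LOQ V" "signed_braid_action V"
    by (rule group_action_signed_braid)
  let ?c = "pres_class (signed_braid_gens (card V)) (signed_braid_rels (card V)) [(g, True)]"
  have c: "?c \<in> carrier (signed_braid_group (card V))"
    using g by (simp add: signed_braid_group_def presented_group_def)
  have Y: "generator_act V g X \<in> LOQ V"
    using bij_betwE[OF generator_act_bij[OF g]] X by blast
  have "generator_act V g X \<in> loq_orbit V X"
    unfolding orbit_def using c signed_braid_action_generator[OF assms] by force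
  note YX = this orbit_sym[OF X Y this]
  have mem: "Z \<in> LOQ V" if "Z \<in> loq_orbit V W" "W \<in> LOQ V" for Z W
  proof -
    from that(1) obtain h where "h \<in> carrier (signed_braid_group (card V))"
      and "Z = signed_braid_action V h W"
      by (auto simp: orbit_def)
    then show ?thesis using element_image that(2) by blast
  qed
  show ?thesis
  proof (intro equalityI subsetI)
    fix Z
    show "Z \<in> loq_orbit V X" if "Z \<in> loq_orbit V (generator_act V g X)"
      by (rule orbit_trans[OF X Y mem[OF that Y] YX(1) that])
    show "Z \<in> loq_orbit V (generator_act V g X)" if "Z \<in> loq_orbit V X"
      by (rule orbit_trans[OF Y X mem[OF that X] YX(2) that])
  qed
qed

lemma loq_orbit_shear:
  assumes b: "skew_on V b" and \<tau>: "linear_ordering V (us @ a # c # vs)"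
  shows "loq_orbit V (quiver_of (shear 1 a c b), us @ c # a # vs) =
    loq_orbit V (quiver_of b, us @ a # c # vs)"
proof -
  \<comment> \<open>\<open>a\<close> has list index \<open>length us\<close>, but braid generators
    are counted from 1.\<close>
  let ?k = "Suc (length us)"
  have k: "?k \<in> {1..<length (us @ a # c # vs)}" by simp
  have "Sig ?k \<in> signed_braid_gens (card V)"
    using k linear_ordering_length[OF \<tau>] by (simp add: signed_braid_gens_def)
  moreover have "switch_at ?k (us @ a # c # vs) = us @ c # a # vs"
    by (simp add: switch_at_def list_update_append nth_append)
  ultimately show ?thesis
    using loq_orbit_generator_act[of "Sig ?k" V "(quiver_of b, us @ a # c # vs)"]
      generator_act_Sig[OF b \<tau> k] LOQ_I[OF b \<tau>]
    by (simp add: nth_append)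
qed

lemma loq_orbit_flip:
  assumes b: "skew_on V b" and \<tau>: "linear_ordering V \<tau>" and j: "j \<in> V"
  shows "loq_orbit V (quiver_of (flip j b), \<tau>) = loq_orbit V (quiver_of b, \<tau>)"
proof -
  obtain i where i: "i < length \<tau>" "\<tau> ! i = j"
    using \<tau> j by (metis in_set_conv_nth linear_ordering_def)
  then have "Rho (Suc i) \<in> signed_braid_gens (card V)"
    using linear_ordering_length[OF \<tau>] by (simp add: signed_braid_gens_def)
  from loq_orbit_generator_act[OF this LOQ_I[OF b \<tau>]] show ?thesis
    using i by (simp add: generator_act_Rho[OF b])
qed

section \<open>Moving the first vertex past a set\<close>

text \<open>For skew \<open>b\<close> the second branch is minus the first with \<open>x\<close> and
  \<open>y\<close> exchanged, so skew-symmetry is kept. Entries at \<open>a\<close> never change, so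
  the products can always be read off the original \<open>b\<close>.\<close>

definition pass :: "'v \<Rightarrow> 'v set \<Rightarrow> ('v \<Rightarrow> 'v \<Rightarrow> int) \<Rightarrow> 'v \<Rightarrow> 'v \<Rightarrow> int" where
  "pass a A b = (\<lambda>x y.
     if x \<noteq> a \<and> y \<noteq> a \<and> x \<notin> A \<and> y \<in> A then b x y + b x a * b a y
     else if x \<noteq> a \<and> y \<noteq> a \<and> x \<in> A \<and> y \<notin> A then b x y + b a x * b a y
     else b x y)"

lemma pass_empty [simp]: "pass a {} b = b"
  by (intro ext) (simp add: pass_def)

text \<open>Only entries at \<open>c\<close> change. For \<open>x\<close> outside \<open>A\<close>
  the shear creates the term \<open>b a c * b x a\<close>. For \<open>x\<close> in \<open>A\<close>
  this same term cancels \<open>b a x * b a c\<close>, left over from when \<open>x\<close> was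
  passed, because \<open>b x a = - b a x\<close>.\<close>

lemma shear_pass:
  assumes b: "skew_on V b" and "a \<notin> A" "c \<notin> A" "c \<noteq> a"
  shows "shear 1 a c (pass a A b) = pass a (insert c A) b"
proof (intro ext)
  fix x y
  show "shear 1 a c (pass a A b) x y = pass a (insert c A) b x y"
    using assms(2-) skew_onD(1)[OF b, of x a] skew_onD(1)[OF b, of y a]
      skew_onD(2)[OF b, of a] skew_onD(2)[OF b, of c]
    by (auto simp: shear_def pass_def algebra_simps)
qed

text \<open>Apart from \<open>a\<close>, only vertices outside \<open>V\<close> lie outside the set,
  and \<open>b\<close> vanishes on them, so every added product is 0.\<close>

lemma pass_complement:
  assumes b: "skew_on V b"
  shows "pass a (V - {a}) b = b"
proof (intro ext)
  fix x y
  have "b z w = 0" "b w z = 0" if "z \<notin> V" for z w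
    using that skew_onD(3,4)[OF b] by blast+
  then show "pass a (V - {a}) b x y = b x y"
    by (auto simp: pass_def)
qed

text \<open>Induction from the right end of \<open>xs\<close>: \<open>a\<close> has passed
  \<open>xs\<close> and then crosses one more vertex \<open>c\<close> by a shear. Skewness is
  carried along because \<open>loq_orbit_shear\<close> needs it.\<close>

lemma loq_orbit_pass:
  assumes b: "skew_on V b" and \<tau>: "linear_ordering V (a # xs @ ys)"
  shows "skew_on V (pass a (set xs) b) \<and>
    loq_orbit V (quiver_of (pass a (set xs) b), xs @ a # ys) =
    loq_orbit V (quiver_of b, a # xs @ ys)"
  using \<tau>
proof (induction xs arbitrary: ys rule: rev_induct)
  case Nil
  then show ?case using b by simp
next
  case (snoc c xs)
  have \<tau>: "linear_ordering V (a # xs @ c # ys)" "linear_ordering V (xs @ a # c # ys)"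
    using snoc.prems by (auto simp: linear_ordering_def)
  note IH = snoc.IH[OF \<tau>(1)]
  have "a \<notin> set xs" "c \<notin> set xs" "c \<noteq> a" "a \<in> V" "c \<in> V"
    using \<tau>(1) by (auto simp: linear_ordering_def)
  then have "shear 1 a c (pass a (set xs) b) = pass a (set (xs @ [c])) b"
    and "skew_on V (shear 1 a c (pass a (set xs) b))"
    using shear_pass[OF b, of a "set xs" c] skew_on_shear[OF conjunct1[OF IH], of a c 1]
    by simp_all
  then show ?case
    using loq_orbit_shear[OF conjunct1[OF IH] \<tau>(2)] IH by simp
qed

section \<open>Independence of the compatible linear ordering\<close>

lemma loq_orbit_rotate:
  assumes b: "skew_on V b" and \<tau>: "linear_ordering V \<tau>"
  shows "loq_orbit V (quiver_of b, rotate m \<tau>) = loq_orbit V (quiver_of b, \<tau>)"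
proof (induction m)
  case (Suc m)
  have lin: "linear_ordering V (rotate m \<tau>)" using \<tau> by (simp add: linear_ordering_def)
  show ?case
  proof (cases "rotate m \<tau>")
    case Nil
    then show ?thesis by simp
  next
    case (Cons a xs)
    then have "linear_ordering V (a # xs @ [])" "set xs = V - {a}"
      using lin by (auto simp: linear_ordering_def)
    then have "loq_orbit V (quiver_of b, rotate1 (rotate m \<tau>)) =
        loq_orbit V (quiver_of b, rotate m \<tau>)"
      using loq_orbit_pass[OF b, of a xs "[]"] Cons pass_complement[OF b] by simp
    then show ?thesis using Suc by simp
  qed
qed simp

lemma loq_orbit_cyclic_ordering:
  assumes "(Q, \<sigma>) \<in> COQ V" "\<tau> \<in> \<sigma>" "\<tau>' \<in> \<sigma>"
  shows "loq_orbit V (Q, \<tau>) = loq_orbit V (Q, \<tau>')"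
proof -
  from assms(1) obtain \<tau>\<^sub>0 where Q: "quiver_on V Q" and \<tau>\<^sub>0: "linear_ordering V \<tau>\<^sub>0"
    and \<sigma>: "\<sigma> = cyclic_class \<tau>\<^sub>0"
    by (auto simp: COQ_def cyclic_ordering_def)
  have "loq_orbit V (Q, rotate m \<tau>\<^sub>0) = loq_orbit V (Q, \<tau>\<^sub>0)" for m
    using loq_orbit_rotate[OF skew_on_signed_arrows[OF Q] \<tau>\<^sub>0] quiver_of_signed_arrows[OF Q] by simp
  then show ?thesis using assms(2,3) by (auto simp: \<sigma> cyclic_class_def)
qed

lemma COQ_linear_ordering: "(Q, \<sigma>) \<in> COQ V \<Longrightarrow> \<tau> \<in> \<sigma> \<Longrightarrow> linear_ordering V \<tau>"
  by (auto simp: COQ_def cyclic_ordering_def cyclic_class_def linear_ordering_def)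

lemma cyclic_class_self: "\<tau> \<in> cyclic_class \<tau>"
  unfolding cyclic_class_def by (metis rangeI rotate0 id_apply)

section \<open>Mutation and invariance under moves\<close>

text \<open>The hypotheses on \<open>A\<close> fix the sign of \<open>b z j\<close> on each side of
  \<open>A\<close>, so every path \<open>x\<close> to \<open>j\<close> to \<open>y\<close> enters
  \<open>A\<close> at its second arrow. There the number of composite arrows is exactly the product
  added by \<open>pass\<close>; \<open>flip\<close> reverses the arrows at \<open>j\<close>.\<close>

lemma mutation_eq_flip_pass:
  assumes b: "skew_on V b" and j: "j \<notin> A"
    and Out: "Out_set (quiver_of b) j \<subseteq> A" and In: "In_set (quiver_of b) j \<inter> A = {}"
  shows "mutation j (quiver_of b) = quiver_of (flip j (pass j A b))"
proof (intro ext)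
  fix x y
  note skew = skew_onD(1)[OF b, of x y] skew_onD(1)[OF b, of j x] skew_onD(1)[OF b, of j y]
    skew_onD(2)[OF b]
  have sgn: "b z j \<le> 0" if "z \<in> A" for z
    using that In by (force simp: In_set_def quiver_of_def)
  have sgn': "b z j \<ge> 0" if "z \<notin> A" for z
    using that Out skew_onD(1)[OF b, of j z] by (force simp: Out_set_def quiver_of_def)
  show "mutation j (quiver_of b) x y = quiver_of (flip j (pass j A b)) x y"
  proof (cases "x = j \<or> y = j")
    case True
    then show ?thesis using skew
      by (auto simp: mutation_def remove_two_cycles_def reverse_at_def add_composite_arrows_def
          quiver_of_def flip_def pass_def)
  next
    case False
    have "mutation j (quiver_of b) x y =
        nat (b x y) + nat (b x j) * nat (b j y) - (nat (b y x) + nat (b y j) * nat (b j x))"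
      using False
      by (simp add: mutation_def remove_two_cycles_def reverse_at_def add_composite_arrows_def
          quiver_of_def)
    also have "\<dots> = nat (b x y + max 0 (b x j) * max 0 (b j y) - max 0 (b y j) * max 0 (b j x))"
    proof -
      \<comment> \<open>Removing 2-cycles by truncated subtraction becomes \<open>nat\<close> of a
        single signed count.\<close>
      have "nat s + p - (nat (- s) + q) = nat (s + int p - int q)" for s p q by linarith
      moreover have "int (nat s * nat t) = max 0 s * max 0 t" for s t by simp
      moreover have "b y x = - b x y" by (rule skew_onD(1)[OF b])
      ultimately show ?thesis by metis
    qed
    also have "\<dots> = quiver_of (flip j (pass j A b)) x y"
      using False skew sgn[of x] sgn[of y] sgn'[of x] sgn'[of y]
      by (cases "x \<in> A"; cases "y \<in> A")
        (simp_all add: quiver_of_def flip_def pass_def max_def mult.commute)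
    finally show ?thesis .
  qed
qed

lemma coq_move_loq_orbit:
  assumes X: "(Q, \<sigma>) \<in> COQ V" and move: "coq_move (Q, \<sigma>) (Q', \<sigma>')"
  shows "(Q', \<sigma>') \<in> COQ V \<and>
    (\<forall>\<tau>\<in>\<sigma>. \<forall>\<tau>'\<in>\<sigma>'. loq_orbit V (Q, \<tau>) = loq_orbit V (Q', \<tau>'))"
proof -
  obtain b where b: "skew_on V b" and Q: "Q = quiver_of b"
  proof
    have "quiver_on V Q" using X by (simp add: COQ_def)
    then show "skew_on V (signed_arrows Q)" "Q = quiver_of (signed_arrows Q)"
      by (simp_all add: skew_on_signed_arrows quiver_of_signed_arrows)
  qed
  \<comment> \<open>One representative on each side suffices: each move supplies such a pair, and
    the orbit does not depend on the choice within a cyclic class.\<close>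
  have "\<exists>\<tau>\<^sub>0\<in>\<sigma>. \<exists>b' \<tau>\<^sub>1. skew_on V b' \<and> Q' = quiver_of b' \<and> linear_ordering V \<tau>\<^sub>1 \<and>
      \<sigma>' = cyclic_class \<tau>\<^sub>1 \<and> loq_orbit V (Q, \<tau>\<^sub>0) = loq_orbit V (Q', \<tau>\<^sub>1)"
    using move unfolding coq_move_def
  proof
    assume "wiggle (Q, \<sigma>) (Q', \<sigma>')"
    then obtain a c xs where w: "Q' = Q" "a # c # xs \<in> \<sigma>" "Q a c = 0" "Q c a = 0"
      "\<sigma>' = cyclic_class (c # a # xs)"
      by (auto simp: wiggle_def)
    have \<tau>: "linear_ordering V (a # c # xs)" by (rule COQ_linear_ordering[OF X w(2)])
    then have \<tau>': "linear_ordering V (c # a # xs)" by (auto simp: linear_ordering_def)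
    have "b a c = 0" using w(3,4) skew_onD(1)[OF b, of a c] by (simp add: Q quiver_of_def)
    then have "shear 1 a c b = b" by (intro ext) (simp add: shear_def)
    then have "loq_orbit V (Q, a # c # xs) = loq_orbit V (Q, c # a # xs)"
      using loq_orbit_shear[OF b, of "[]" a c xs] \<tau> by (simp add: Q)
    then show ?thesis using w(1,2,5) \<tau>' b Q by metis
  next
    assume "\<exists>j. proper_mutation_at j (Q, \<sigma>) (Q', \<sigma>')"
    then obtain j xs ys where m: "Q' = mutation j Q" "j # xs @ ys \<in> \<sigma>"
      "Out_set Q j \<subseteq> set xs" "In_set Q j \<inter> set xs = {}" "\<sigma>' = cyclic_class (xs @ j # ys)"
      by (auto simp: proper_mutation_at_def)
    have \<tau>: "linear_ordering V (j # xs @ ys)" by (rule COQ_linear_ordering[OF X m(2)])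
    then have \<tau>': "linear_ordering V (xs @ j # ys)" and j: "j \<in> V" "j \<notin> set xs"
      by (auto simp: linear_ordering_def)
    let ?b = "pass j (set xs) b"
    have p: "skew_on V ?b"
      "loq_orbit V (quiver_of ?b, xs @ j # ys) = loq_orbit V (Q, j # xs @ ys)"
      using loq_orbit_pass[OF b \<tau>] by (simp_all add: Q)
    have "Q' = quiver_of (flip j ?b)"
      using mutation_eq_flip_pass[OF b j(2)] m by (simp add: Q)
    then show ?thesis
      using m(2,5) \<tau>' skew_on_flip[OF p(1)] loq_orbit_flip[OF p(1) \<tau>' j(1)] p(2) by metis
  qed
  then obtain \<tau>\<^sub>0 b' \<tau>\<^sub>1 where s: "\<tau>\<^sub>0 \<in> \<sigma>" "skew_on V b'" "Q' = quiver_of b'"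
    "linear_ordering V \<tau>\<^sub>1" "\<sigma>' = cyclic_class \<tau>\<^sub>1"
    "loq_orbit V (Q, \<tau>\<^sub>0) = loq_orbit V (Q', \<tau>\<^sub>1)"
    by blast
  have Y: "(Q', \<sigma>') \<in> COQ V"
    using s quiver_on_quiver_of by (auto simp: COQ_def cyclic_ordering_def)
  moreover have "\<tau>\<^sub>1 \<in> \<sigma>'" using s(5) cyclic_class_self by simp
  ultimately show ?thesis
    using loq_orbit_cyclic_ordering[OF X _ s(1)] loq_orbit_cyclic_ordering[OF Y] s(6) by metis
qed

theorem theorem19p1:
  fixes V :: "'v set" and n :: nat
    and Q Q' :: "'v quiver" and \<sigma> \<sigma>' :: "'v list set" and \<tau> \<tau>' :: "'v list"
  assumes "finite V" and "card V = n"
    and "(Q, \<sigma>) \<in> COQ V" and "(Q', \<sigma>') \<in> COQ V"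
    and "coq_move\<^sup>*\<^sup>* (Q, \<sigma>) (Q', \<sigma>')"
    and "\<tau> \<in> \<sigma>" and "\<tau>' \<in> \<sigma>'"
  shows "orbit (signed_braid_group n) (signed_braid_action V) (Q, \<tau>) =
         orbit (signed_braid_group n) (signed_braid_action V) (Q', \<tau>')"
proof -
  have "(Q', \<sigma>') \<in> COQ V \<and> (\<forall>\<tau>'\<in>\<sigma>'. loq_orbit V (Q, \<tau>) = loq_orbit V (Q', \<tau>'))"
    using assms(5)
  proof (induction rule: rtranclp_induct2)
    case refl
    then show ?case
      using assms(3,6) loq_orbit_cyclic_ordering by blast
  next
    case (step Q\<^sub>1 \<sigma>\<^sub>1 Q\<^sub>2 \<sigma>\<^sub>2)
    have X: "(Q\<^sub>1, \<sigma>\<^sub>1) \<in> COQ V" using step.IH by blast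
    \<comment> \<open>Both orbit equations quantify universally over
      \<open>\<sigma>\<^sub>1\<close>, so joining them needs an actual member of this class.\<close>
    then obtain \<tau>\<^sub>1 where "\<tau>\<^sub>1 \<in> \<sigma>\<^sub>1"
      using cyclic_class_self by (auto simp: COQ_def cyclic_ordering_def)
    then show ?case
      using coq_move_loq_orbit[OF X step.hyps(2)] step.IH by blast
  qed
  then show ?thesis using assms(2,7) by blast
qed

end
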